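(* The map $W\mapsto(P(W),Q(W))$ is a bijection between injective words over $\overline{\mathbb{Z}}$ and pairs $(P,Q)$ such that, for some common indexed forest $F$, $P\in\mathsf{LBS}(F)$ and $Q$ is a decreasing labeling of $F$.
   Context: Indexed forests: for a finite $S\subset\mathbb{Z}$ with maximal consecutive blocks $I_1<\cdots<I_k$, an indexed forest $F$ with support $\mathrm{Supp}(F)=S$ consists of plane binary trees $T_1,\dots,T_k$, $T_j$ having $|I_j|$ nodes canonically labeled by $I_j$ in inorder. $\operatorname{IN}(F)$ is the set of nodes. $\mathrm{INT}(u,F)$ is the set of canonical labels of the subtree rooted at $u$. $\overline{\mathbb{Z}}$ is the set of symbols $(i,j)$, $i\in\mathbb{Z}$, $j\ge1$, totally ordered lexicographically, with $\mathrm{val}(i,j)=i$. A word is injective if its letters are pairwise distinct. $\mathsf{LBS}(F)$ is the set of injective $\rho:\operatorname{IN}(F)\to\overline{\mathbb{Z}}$ with $\rho(v)<\rho(u)$ for $v$ the left child of $u$, $\rho(u)<\rho(v)$ for $v$ the right child of $u$, and $\mathrm{val}(\rho(u))\in\mathrm{INT}(u,F)$. A decreasing labeling of $F$ is a bijection $\operatorname{IN}(F)\to\{1,\dots,|F|\}$ in which each node has a larger label than its children. Insertion: for $W$ empty, $F(W)$ is empty. For $W=W'a$, let $F'=F(W')$ have blocks $I_1<\cdots<I_k$, roots $u_j$ and root labels $a_j=P(W')(u_j)$, and let $i=\mathrm{val}(a)$. Add a new root $u$ as follows. (i) If $i\notin\mathrm{Supp}(F')$: $u$ gets canonical label $i$;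 its left child is $u_j$ if $i-1\in I_j$ (else none), and its right child is $u_{j'}$ if $i+1\in I_{j'}$ (else none). (ii) If $i\in I_j$ and $a>a_j$: the left child of $u$ is $u_j$ and the right child is $u_{j+1}$ if $\max I_j+2\in\mathrm{Supp}(F')$ (else none). The support becomes $\mathrm{Supp}(F')\cup\{\max I_j+1\}$. (iii) If $i\in I_j$ and $a<a_j$: the right child of $u$ is $u_j$ and the left child is $u_{j-1}$ if $\min I_j-2\in\mathrm{Supp}(F')$ (else none). The support becomes $\mathrm{Supp}(F')\cup\{\min I_j-1\}$. Other trees are unchanged. $P(W)$ extends $P(W')$ by $u\mapsto a$, and $Q(W)$ extends $Q(W')$ by $u\mapsto|W|$. *)

theory Defs
  imports "HOL-Library.Tree" "HOL-Library.Product_Lexorder" "HOL-Library.FuncSet"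
begin

text \<open>
  Letters \<open>(i, j)\<close> with \<open>j \<ge> 1\<close>; the order on pairs is the lexicographic one of
  \<^theory>\<open>HOL-Library.Product_Lexorder\<close>.
\<close>

type_synonym letter = "int \<times> nat"

definition Zbar :: "letter set" where
  "Zbar = {(i, j). 1 \<le> j}"

abbreviation val :: "letter \<Rightarrow> int" where
  "val \<equiv> fst"

definition injective_words :: "letter list set" where
  "injective_words = {W. set W \<subseteq> Zbar \<and> distinct W}"

definition blocks :: "int set \<Rightarrow> int set set" where
  "blocks S = {{a..b} | a b. a \<le> b \<and> {a..b} \<subseteq> S \<and> a - 1 \<notin> S \<and> b + 1 \<notin> S}"

text \<open>
  A forest is the set of its trees, and the entry stored at a node is the canonical label of
  that node. Canonical labels are pairwise distinct, so nodes are identified with them; in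
  particular the set of nodes of a forest coincides with its support.
\<close>

type_synonym forest = "int tree set"

definition Supp :: "forest \<Rightarrow> int set" where
  "Supp F = (\<Union>T\<in>F. set_tree T)"

abbreviation IN :: "forest \<Rightarrow> int set" where
  "IN F \<equiv> Supp F"

definition indexed_forest :: "forest \<Rightarrow> bool" where
  "indexed_forest F \<longleftrightarrow>
     finite (Supp F) \<and>
     bij_betw set_tree F (blocks (Supp F)) \<and>
     (\<forall>T\<in>F. inorder T = sorted_list_of_set (set_tree T))"

definition left_child :: "forest \<Rightarrow> int \<Rightarrow> int \<Rightarrow> bool" where
  "left_child F v u \<longleftrightarrow> (\<exists>T\<in>F. \<exists>l r r'. \<langle>\<langle>l, v, r\<rangle>, u, r'\<rangle> \<in> subtrees T)"

definition right_child :: "forest \<Rightarrow> int \<Rightarrow> int \<Rightarrow> bool" where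
  "right_child F v u \<longleftrightarrow> (\<exists>T\<in>F. \<exists>l' l r. \<langle>l', u, \<langle>l, v, r\<rangle>\<rangle> \<in> subtrees T)"

definition INT_labels :: "int \<Rightarrow> forest \<Rightarrow> int set" where
  "INT_labels u F = {w. \<exists>T\<in>F. \<exists>l r. \<langle>l, u, r\<rangle> \<in> subtrees T \<and> w \<in> set_tree \<langle>l, u, r\<rangle>}"

definition LBS :: "forest \<Rightarrow> (int \<Rightarrow> letter) set" where
  "LBS F = {\<rho> \<in> IN F \<rightarrow>\<^sub>E Zbar.
     inj_on \<rho> (IN F) \<and>
     (\<forall>u v. left_child F v u \<longrightarrow> \<rho> v < \<rho> u) \<and>
     (\<forall>u v. right_child F v u \<longrightarrow> \<rho> u < \<rho> v) \<and>
     (\<forall>u\<in>IN F. val (\<rho> u) \<in> INT_labels u F)}"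

definition decreasing_labelings :: "forest \<Rightarrow> (int \<Rightarrow> nat) set" where
  "decreasing_labelings F = {\<kappa> \<in> extensional (IN F).
     bij_betw \<kappa> (IN F) {1..card (IN F)} \<and>
     (\<forall>u v. left_child F v u \<or> right_child F v u \<longrightarrow> \<kappa> v < \<kappa> u)}"

text \<open>The tree of \<open>F\<close> whose block contains \<open>i\<close>, and the empty tree if there is none.\<close>

definition tree_at :: "forest \<Rightarrow> int \<Rightarrow> int tree" where
  "tree_at F i = (if i \<in> Supp F then THE T. T \<in> F \<and> i \<in> set_tree T else \<langle>\<rangle>)"

text \<open>
  The tree created by inserting \<open>a\<close>. The last branch is the case \<open>a < \<rho> (value T)\<close>: equality
  does not occur along an injective word.
\<close>

definition new_tree :: "forest \<Rightarrow> (int \<Rightarrow> letter) \<Rightarrow> letter \<Rightarrow> int tree" where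
  "new_tree F \<rho> a =
    (let i = val a; T = tree_at F i; m = Min (set_tree T); M = Max (set_tree T) in
     if i \<notin> Supp F then \<langle>tree_at F (i - 1), i, tree_at F (i + 1)\<rangle>
     else if a > \<rho> (value T) then \<langle>T, M + 1, tree_at F (M + 2)\<rangle>
     else \<langle>tree_at F (m - 2), m - 1, T\<rangle>)"

text \<open>
  The recursion removes the last letter of the word, hence runs on the reversed word. Nodes keep
  their canonical labels under insertion, so extending a labeling is a function update.
\<close>

primrec insertion_rev :: "letter list \<Rightarrow> forest \<times> (int \<Rightarrow> letter) \<times> (int \<Rightarrow> nat)" where
  "insertion_rev [] = ({}, (\<lambda>_. undefined), (\<lambda>_. undefined))"
| "insertion_rev (a # W) =
    (case insertion_rev W of (F, \<rho>, \<kappa>) \<Rightarrow>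
      (case new_tree F \<rho> a of \<langle>l, u, r\<rangle> \<Rightarrow>
        (insert \<langle>l, u, r\<rangle> (F - {l, r}), \<rho>(u := a), \<kappa>(u := Suc (length W)))))"

definition insertion :: "letter list \<Rightarrow> forest \<times> (int \<Rightarrow> letter) \<times> (int \<Rightarrow> nat)" where
  "insertion W = insertion_rev (rev W)"

lemma insertion_Nil: "insertion [] = ({}, (\<lambda>_. undefined), (\<lambda>_. undefined))"
  by (simp add: insertion_def)

lemma insertion_snoc:
  "insertion (W @ [a]) =
    (case insertion W of (F, \<rho>, \<kappa>) \<Rightarrow>
      (case new_tree F \<rho> a of \<langle>l, u, r\<rangle> \<Rightarrow>
        (insert \<langle>l, u, r\<rangle> (F - {l, r}), \<rho>(u := a), \<kappa>(u := length (W @ [a])))))"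
  by (simp add: insertion_def split: prod.split tree.split)

text \<open>A labeled forest is a forest together with a labeling of its nodes.\<close>

definition P_symbol :: "letter list \<Rightarrow> forest \<times> (int \<Rightarrow> letter)" where
  "P_symbol W = (case insertion W of (F, \<rho>, \<kappa>) \<Rightarrow> (F, \<rho>))"

definition Q_symbol :: "letter list \<Rightarrow> forest \<times> (int \<Rightarrow> nat)" where
  "Q_symbol W = (case insertion W of (F, \<rho>, \<kappa>) \<Rightarrow> (F, \<kappa>))"

end

theory Submission
  imports Defs
begin

text \<open>
  Every insertion step grafts a new root \<open>u \<notin> Supp F\<close> on top of the (possibly empty) trees
  that reach \<open>u - 1\<close> and \<open>u + 1\<close>. Grafting at \<open>u\<close> with labels \<open>a\<close> and \<open>|F| + 1\<close> yields
  admissible labelings iff the old ones are admissible and \<open>a\<close> satisfies the local conditions at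
  \<open>u\<close>; for a letter \<open>a\<close> not yet used there is exactly one such \<open>u\<close>, and the insertion rule selects
  it. Conversely, the node with the largest decreasing label is a root, and removing it undoes the
  last step.
\<close>

section \<open>Indexed forests and grafting\<close>

text \<open>Blocks depend on the whole support, which is awkward when a single tree changes. The
  last condition replaces them by a pairwise one: distance 0 expresses disjointness and distance 1
  maximality of the blocks. The inorder condition amounts to the search tree property.\<close>

lemma indexed_forest_iff:
  "indexed_forest F \<longleftrightarrow> finite (Supp F) \<and>
     (\<forall>T\<in>F. bst T \<and> (\<exists>a b. a \<le> b \<and> set_tree T = {a..b})) \<and>
     (\<forall>T\<in>F. \<forall>T'\<in>F. \<forall>x\<in>set_tree T. \<forall>y\<in>set_tree T'. \<bar>x - y\<bar> \<le> 1 \<longrightarrow> T = T')"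
  (is "_ \<longleftrightarrow> _ \<and> ?int \<and> ?gap")
proof
  assume F: "indexed_forest F"
  then have inj: "inj_on set_tree F" and im: "set_tree ` F = blocks (Supp F)"
    by (auto simp: indexed_forest_def bij_betw_def)
  have bl: "\<exists>a b. set_tree T = {a..b} \<and> a \<le> b \<and> {a..b} \<subseteq> Supp F \<and> a - 1 \<notin> Supp F \<and> b + 1 \<notin> Supp F"
    if "T \<in> F" for T
  proof -
    have "set_tree T \<in> blocks (Supp F)"
      using im that by blast
    then show ?thesis
      by (auto simp: blocks_def)
  qed
  have bst: "bst T" if "T \<in> F" for T
    using F that unfolding indexed_forest_def bst_iff_sorted_wrt_less by simp
  have "T = T'" if T: "T \<in> F" "T' \<in> F" "x \<in> set_tree T" "y \<in> set_tree T'" "\<bar>x - y\<bar> \<le> 1" for T T' x y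
  proof -
    obtain a b where ab: "set_tree T = {a..b}" "{a..b} \<subseteq> Supp F" "a - 1 \<notin> Supp F" "b + 1 \<notin> Supp F"
      using bl[OF T(1)] by blast
    obtain c d where cd: "set_tree T' = {c..d}" "{c..d} \<subseteq> Supp F" "c - 1 \<notin> Supp F" "d + 1 \<notin> Supp F"
      using bl[OF T(2)] by blast
    \<comment> \<open>Both intervals are maximal in the support, so neither contains a point just
      outside the other. Intervals that overlap or touch must then coincide.\<close>
    have "a - 1 \<notin> {c..d}" "b + 1 \<notin> {c..d}" "c - 1 \<notin> {a..b}" "d + 1 \<notin> {a..b}"
      using ab cd by blast+
    then have "a = c" "b = d"
      using T(3-5) ab(1) cd(1) by auto
    then show ?thesis
      using inj_onD[OF inj _ T(1,2)] ab(1) cd(1) by simp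
  qed
  moreover have "finite (Supp F)"
    using F by (simp add: indexed_forest_def)
  ultimately show "finite (Supp F) \<and> ?int \<and> ?gap"
    using bl bst by meson
next
  assume *: "finite (Supp F) \<and> ?int \<and> ?gap"
  then have fin: "finite (Supp F)" and int: ?int and gap: ?gap by blast+
  have inj: "inj_on set_tree F"
  proof (rule inj_onI)
    fix T T' assume T: "T \<in> F" "T' \<in> F" "set_tree T = set_tree T'"
    then obtain a b where "a \<le> b" "set_tree T = {a..b}" using int by blast
    then have "a \<in> set_tree T" "a \<in> set_tree T'" using T(3) by auto
    then show "T = T'" using gap T(1,2) by fastforce
  qed
  have out: "a - 1 \<notin> Supp F" "b + 1 \<notin> Supp F" "{a..b} \<subseteq> Supp F"
    if T: "T \<in> F" "set_tree T = {a..b}" "a \<le> b" for T a b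
  proof -
    \<comment> \<open>A point of the support next to \<open>T\<close> would lie in a tree that the
      gap condition identifies with \<open>T\<close>.\<close>
    have "x \<notin> Supp F" if x: "x \<notin> set_tree T" "y \<in> set_tree T" "\<bar>y - x\<bar> \<le> 1" for x y
    proof
      assume "x \<in> Supp F"
      then obtain T' where T': "T' \<in> F" "x \<in> set_tree T'" by (auto simp: Supp_def)
      have "T = T'" using gap[rule_format, OF T(1) T'(1) x(2) T'(2) x(3)] .
      then show False using x(1) T'(2) by blast
    qed
    from this[of "a - 1" a] this[of "b + 1" b] show "a - 1 \<notin> Supp F" "b + 1 \<notin> Supp F"
      using T(2,3) by auto
    show "{a..b} \<subseteq> Supp F"
      using T by (auto simp: Supp_def)
  qed
  have "set_tree ` F = blocks (Supp F)"
  proof (intro equalityI subsetI)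
    fix I assume "I \<in> set_tree ` F"
    then obtain T where T: "T \<in> F" "I = set_tree T" by blast
    then obtain a b where "a \<le> b" "set_tree T = {a..b}" using int by blast
    then show "I \<in> blocks (Supp F)"
      using out[OF T(1)] T(2) unfolding blocks_def by blast
  next
    fix I assume "I \<in> blocks (Supp F)"
    then obtain a b where ab: "I = {a..b}" "a \<le> b" "{a..b} \<subseteq> Supp F" "a - 1 \<notin> Supp F" "b + 1 \<notin> Supp F"
      by (auto simp: blocks_def)
    then obtain T where T: "T \<in> F" "a \<in> set_tree T"
      by (force simp: Supp_def)
    then obtain c d where cd: "c \<le> d" "set_tree T = {c..d}" using int by blast
    note o = out[OF T(1) cd(2) cd(1)]
    have "a - 1 \<notin> {c..d}" "b + 1 \<notin> {c..d}" "c - 1 \<notin> {a..b}" "d + 1 \<notin> {a..b}"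
      using o ab by blast+
    then have "a = c" "b = d"
      using T(2) cd ab(2) by auto
    then show "I \<in> set_tree ` F"
      using T(1) cd(2) ab(1) by blast
  qed
  moreover have "inorder T = sorted_list_of_set (set_tree T)" if "T \<in> F" for T
  proof -
    have "sorted_wrt (<) (inorder T)"
      using int that bst_iff_sorted_wrt_less by blast
    then show ?thesis
      by (intro sorted_distinct_set_unique) (simp_all add: strict_sorted_iff)
  qed
  ultimately show "indexed_forest F"
    using fin inj by (auto simp: indexed_forest_def bij_betw_def)
qed

lemma indexed_forest_finite: "indexed_forest F \<Longrightarrow> finite (Supp F)"
  by (simp add: indexed_forest_def)

lemma indexed_forest_bst: "indexed_forest F \<Longrightarrow> T \<in> F \<Longrightarrow> bst T"
  by (simp add: indexed_forest_iff)

lemma indexed_forest_interval: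
  assumes "indexed_forest F" "T \<in> F"
  obtains a b where "a \<le> b" "set_tree T = {a..b}"
  using assms by (auto simp: indexed_forest_iff)

lemma indexed_forest_gap:
  "indexed_forest F \<Longrightarrow> T \<in> F \<Longrightarrow> T' \<in> F \<Longrightarrow> x \<in> set_tree T \<Longrightarrow> y \<in> set_tree T' \<Longrightarrow>
    \<bar>x - y\<bar> \<le> 1 \<Longrightarrow> T = T'"
  unfolding indexed_forest_iff by blast

lemma Leaf_notin_indexed_forest: "indexed_forest F \<Longrightarrow> \<langle>\<rangle> \<notin> F"
  by (force elim: indexed_forest_interval)

section \<open>Locating the tree through a given label\<close>

lemma tree_at_eqI:
  assumes "indexed_forest F" "T \<in> F" "i \<in> set_tree T"
  shows "tree_at F i = T"
proof -
  have "(THE T. T \<in> F \<and> i \<in> set_tree T) = T"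
    using assms indexed_forest_gap[OF assms(1)] by (intro the_equality) auto
  then show ?thesis
    using assms by (auto simp: tree_at_def Supp_def)
qed

lemma tree_at_mem:
  assumes "indexed_forest F" "i \<in> Supp F"
  shows "tree_at F i \<in> F" "i \<in> set_tree (tree_at F i)"
  using assms tree_at_eqI[OF assms(1)] by (auto simp: Supp_def)

lemma tree_at_Leaf [simp]: "i \<notin> Supp F \<Longrightarrow> tree_at F i = \<langle>\<rangle>"
  by (simp add: tree_at_def)

lemma tree_at_in_forest_or_Leaf: "indexed_forest F \<Longrightarrow> tree_at F i \<in> F \<or> tree_at F i = \<langle>\<rangle>"
  using tree_at_mem(1) tree_at_Leaf by blast

lemma set_tree_at_subset: "indexed_forest F \<Longrightarrow> set_tree (tree_at F i) \<subseteq> Supp F"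
  using tree_at_in_forest_or_Leaf[of F i] by (auto simp: Supp_def)

text \<open>As \<open>u\<close> is missing from the support, the block through \<open>u - 1\<close>
  ends there. The choice \<open>a = u\<close> gives an empty interval, so one formula also covers
  the empty tree.\<close>

lemma set_tree_at_below:
  assumes F: "indexed_forest F" and u: "u \<notin> Supp F"
  obtains a where "a \<le> u" "set_tree (tree_at F (u - 1)) = {a..u - 1}"
proof (cases "u - 1 \<in> Supp F")
  case True
  note t = tree_at_mem[OF F True]
  obtain a b where ab: "a \<le> b" "set_tree (tree_at F (u - 1)) = {a..b}"
    using indexed_forest_interval[OF F t(1)] .
  have "u \<notin> {a..b}"
    using set_tree_at_subset[OF F] ab(2) u by blast
  then show ?thesis
    using that[of a] t(2) ab by auto
next
  case False
  then show ?thesis using that[of u] by simp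
qed

lemma set_tree_at_above:
  assumes F: "indexed_forest F" and u: "u \<notin> Supp F"
  obtains b where "u \<le> b" "set_tree (tree_at F (u + 1)) = {u + 1..b}"
proof (cases "u + 1 \<in> Supp F")
  case True
  note t = tree_at_mem[OF F True]
  obtain a b where ab: "a \<le> b" "set_tree (tree_at F (u + 1)) = {a..b}"
    using indexed_forest_interval[OF F t(1)] .
  have "u \<notin> {a..b}"
    using set_tree_at_subset[OF F] ab(2) u by blast
  then show ?thesis
    using that[of b] t(2) ab by auto
next
  case False
  then show ?thesis using that[of u] by simp
qed

section \<open>Adding a root and taking it off again\<close>

definition grafted_tree :: "forest \<Rightarrow> int \<Rightarrow> int tree" where
  "grafted_tree F u = \<langle>tree_at F (u - 1), u, tree_at F (u + 1)\<rangle>"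

text \<open>An empty neighbour causes no harm in the set difference, because \<open>Leaf\<close> is
  never a member of an indexed forest.\<close>

definition graft :: "forest \<Rightarrow> int \<Rightarrow> forest" where
  "graft F u = insert (grafted_tree F u) (F - {tree_at F (u - 1), tree_at F (u + 1)})"

lemma Supp_graft: "indexed_forest F \<Longrightarrow> Supp (graft F u) = insert u (Supp F)"
  using set_tree_at_subset[of F "u - 1"] set_tree_at_subset[of F "u + 1"]
  by (auto simp: graft_def grafted_tree_def Supp_def)

text \<open>The trees removed from \<open>F\<close> survive as subtrees of the new root, so nothing
  is lost. The empty tree is excluded: it would appear as a new subtree when \<open>F\<close> is
  empty.\<close>

lemma nonempty_subtrees_graft:
  assumes "indexed_forest F"
  shows "(\<exists>T\<in>graft F u. \<langle>l, w, r\<rangle> \<in> subtrees T) \<longleftrightarrow>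
    \<langle>l, w, r\<rangle> = grafted_tree F u \<or> (\<exists>T\<in>F. \<langle>l, w, r\<rangle> \<in> subtrees T)"
  using tree_at_in_forest_or_Leaf[OF assms, of "u - 1"] tree_at_in_forest_or_Leaf[OF assms, of "u + 1"]
  by (auto simp: graft_def grafted_tree_def)

text \<open>The absorbed trees fill intervals ending at \<open>u - 1\<close> and starting at
  \<open>u + 1\<close>, so together with \<open>u\<close> they form one interval again. A remaining
  tree cannot come too close, since every neighbour of \<open>u\<close> in the support has been
  absorbed.\<close>

lemma indexed_forest_graft:
  assumes F: "indexed_forest F" and u: "u \<notin> Supp F"
  shows "indexed_forest (graft F u)"
proof -
  let ?l = "tree_at F (u - 1)" and ?r = "tree_at F (u + 1)"
  obtain a where a: "a \<le> u" "set_tree ?l = {a..u - 1}"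
    using set_tree_at_below[OF F u] .
  obtain b where b: "u \<le> b" "set_tree ?r = {u + 1..b}"
    using set_tree_at_above[OF F u] .
  have lr: "?l \<in> F \<or> ?l = \<langle>\<rangle>" "?r \<in> F \<or> ?r = \<langle>\<rangle>"
    using tree_at_in_forest_or_Leaf[OF F] by auto
  then have "bst ?l" "bst ?r"
    using indexed_forest_bst[OF F] by force+
  then have bst: "bst (grafted_tree F u)"
    using a b by (auto simp: grafted_tree_def)
  have "set_tree (grafted_tree F u) = {a..b}"
    using a b by (auto simp: grafted_tree_def)
  then have int: "\<exists>a b. a \<le> b \<and> set_tree (grafted_tree F u) = {a..b}"
    using a(1) b(1) by (intro exI[of _ a] exI[of _ b]) auto
  have gap: False
    if T: "T \<in> F" "T \<noteq> ?l" "T \<noteq> ?r" "x \<in> set_tree (grafted_tree F u)" "y \<in> set_tree T" "\<bar>x - y\<bar> \<le> 1"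
    for T x y
  proof -
    have y: "y \<in> Supp F" "tree_at F y = T"
      using T tree_at_eqI[OF F] by (auto simp: Supp_def)
    from T(4) consider "x = u" | "x \<in> set_tree ?l" | "x \<in> set_tree ?r"
      by (auto simp: grafted_tree_def)
    then show False
    proof cases
      case 1
      then have "y = u - 1 \<or> y = u + 1"
        using T(6) y(1) u by (cases "y = u") auto
      then show False using y T(2,3) by auto
    next
      case 2
      then have "?l \<in> F" using lr by auto
      then show False using indexed_forest_gap[OF F _ T(1) 2 T(5,6)] T(2) by simp
    next
      case 3
      then have "?r \<in> F" using lr by auto
      then show False using indexed_forest_gap[OF F _ T(1) 3 T(5,6)] T(3) by simp
    qed
  qed
  have old: "T = T'" if "T \<in> F" "T' \<in> F" "x \<in> set_tree T" "y \<in> set_tree T'" "\<bar>x - y\<bar> \<le> 1" for T T' x y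
    using indexed_forest_gap[OF F] that by blast
  have "finite (Supp (graft F u))"
    using F by (simp add: Supp_graft indexed_forest_finite)
  moreover have "bst T \<and> (\<exists>a b. a \<le> b \<and> set_tree T = {a..b})" if "T \<in> graft F u" for T
    using that bst int F unfolding graft_def indexed_forest_iff by blast
  moreover have "T = T'"
    if T: "T \<in> graft F u" "T' \<in> graft F u" "x \<in> set_tree T" "y \<in> set_tree T'" "\<bar>x - y\<bar> \<le> 1" for T T' x y
  proof -
    have "\<bar>y - x\<bar> \<le> 1" using T(5) by simp
    then show ?thesis
      using T gap old unfolding graft_def by blast
  qed
  ultimately show ?thesis
    unfolding indexed_forest_iff by blast
qed

text \<open>Both grafted trees contain \<open>u\<close>, hence are the same tree of the common
  forest. The old forest is recovered by replacing this tree with its nonempty subtrees.\<close>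

lemma inj_graft:
  assumes F: "indexed_forest F" "u \<notin> Supp F" and F': "indexed_forest F'" "u \<notin> Supp F'"
    and eq: "graft F u = graft F' u"
  shows "F = F'"
proof -
  have rec: "F = (graft F u - {grafted_tree F u}) \<union> ({tree_at F (u - 1), tree_at F (u + 1)} - {\<langle>\<rangle>})"
    if F: "indexed_forest F" "u \<notin> Supp F" for F
  proof -
    have "grafted_tree F u \<notin> F"
      using F(2) by (force simp: grafted_tree_def Supp_def)
    then show ?thesis
      using tree_at_in_forest_or_Leaf[OF F(1), of "u - 1"]
        tree_at_in_forest_or_Leaf[OF F(1), of "u + 1"] Leaf_notin_indexed_forest[OF F(1)]
      unfolding graft_def by auto
  qed
  have "grafted_tree F u = grafted_tree F' u"
  proof (rule indexed_forest_gap[OF indexed_forest_graft[OF F]])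
    show "grafted_tree F u \<in> graft F u" by (simp add: graft_def)
    show "grafted_tree F' u \<in> graft F u" unfolding eq by (simp add: graft_def)
    show "u \<in> set_tree (grafted_tree F u)" "u \<in> set_tree (grafted_tree F' u)" "\<bar>u - u\<bar> \<le> 1"
      by (simp_all add: grafted_tree_def)
  qed
  then show ?thesis
    using rec[OF F] rec[OF F'] eq by (simp add: grafted_tree_def)
qed

text \<open>Any root can be taken off, its nonempty subtrees becoming trees of their own. Grafting
  at the freed label puts exactly these two back together.\<close>

lemma graft_surj:
  assumes G: "indexed_forest G" and T: "\<langle>l, u, r\<rangle> \<in> G"
  obtains F where "indexed_forest F" "u \<notin> Supp F" "G = graft F u"
proof -
  let ?T = "\<langle>l, u, r\<rangle>"
  define F where "F = (G - {?T}) \<union> ({l, r} - {\<langle>\<rangle>})"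
  have bst: "bst l" "bst r" "\<forall>x\<in>set_tree l. x < u" "\<forall>x\<in>set_tree r. u < x"
    using indexed_forest_bst[OF G T] by auto
  obtain a b where ab: "a \<le> b" "set_tree ?T = {a..b}"
    using indexed_forest_interval[OF G T] .
  have "u \<in> {a..b}"
    unfolding ab(2)[symmetric] by simp
  then have u: "a \<le> u" "u \<le> b" by auto
  have "set_tree l = {a..b} \<inter> {..<u}" "set_tree r = {a..b} \<inter> {u<..}"
    unfolding ab(2)[symmetric] using bst(3,4) by auto
  moreover have "{a..b} \<inter> {..<u} = {a..u - 1}" "{a..b} \<inter> {u<..} = {u + 1..b}"
    using u by auto
  ultimately have l: "set_tree l = {a..u - 1}" and r: "set_tree r = {u + 1..b}"
    by simp_all
  have other: "\<not> \<bar>x - y\<bar> \<le> 1" if "T' \<in> G" "T' \<noteq> ?T" "x \<in> set_tree T'" "y \<in> {a..b}" for T' x y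
    using indexed_forest_gap[OF G that(1) T that(3)] that(2,4) ab(2) by blast
  have Supp: "Supp F = Supp G - {u}"
  proof -
    have "u \<notin> set_tree T'" if "T' \<in> G" "T' \<noteq> ?T" for T'
      using other[OF that, of u u] u by auto
    then show ?thesis
      using T bst(3,4) unfolding Supp_def F_def by (fastforce split: if_splits)
  qed
  have int_l: "a \<le> u - 1" if "l \<noteq> \<langle>\<rangle>"
    using l that by (cases l) (metis atLeastatMost_empty_iff2 tree.set_intros(2) empty_iff)+
  have int_r: "u + 1 \<le> b" if "r \<noteq> \<langle>\<rangle>"
    using r that by (cases r) (metis atLeastatMost_empty_iff2 tree.set_intros(2) empty_iff)+
  have "finite (Supp F)"
    using G by (simp add: Supp indexed_forest_finite)
  moreover have "bst T' \<and> (\<exists>a b. a \<le> b \<and> set_tree T' = {a..b})" if T': "T' \<in> F" for T'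
  proof -
    from T' consider "T' \<in> G" | "T' = l" "l \<noteq> \<langle>\<rangle>" | "T' = r" "r \<noteq> \<langle>\<rangle>"
      by (auto simp: F_def)
    then show ?thesis
    proof cases
      case 1 then show ?thesis using G by (simp add: indexed_forest_iff)
    next
      case 2 then show ?thesis using bst l int_l by blast
    next
      case 3 then show ?thesis using bst r int_r by blast
    qed
  qed
  moreover have "T1 = T2"
    if "T1 \<in> F" "T2 \<in> F" and xy: "x \<in> set_tree T1" "y \<in> set_tree T2" "\<bar>x - y\<bar> \<le> 1" for T1 T2 x y
  proof -
    have c: "T' \<in> G \<and> T' \<noteq> ?T \<or> T' = l \<or> T' = r" if "T' \<in> F" for T'
      using that by (auto simp: F_def)
    have sub: "z \<in> {a..b}" if "T' \<in> {l, r}" "z \<in> set_tree T'" for T' z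
      using that l r u by auto
    have yx: "\<bar>y - x\<bar> \<le> 1" using xy(3) by simp
    \<comment> \<open>The freed label \<open>u\<close> separates the two subtrees, so their labels
      differ by at least 2.\<close>
    have lr: "\<not> \<bar>x - y\<bar> \<le> 1" if "x \<in> set_tree l" "y \<in> set_tree r" for x y
      using that l r by auto
    have 1: "T1 \<in> G \<and> T1 \<noteq> ?T \<and> T2 \<in> G \<and> T2 \<noteq> ?T \<or> T1 \<in> {l, r} \<and> T2 \<in> {l, r}"
      using c[OF that(1)] c[OF that(2)] other[of T1 x y] other[of T2 y x] xy yx
        sub[of T1 x] sub[of T2 y] by simp metis
    then show ?thesis
      using indexed_forest_gap[OF G _ _ xy] lr[of x y] lr[of y x] xy yx by blast
  qed
  ultimately have F: "indexed_forest F"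
    unfolding indexed_forest_iff by blast
  \<comment> \<open>With an empty left subtree, \<open>u - 1\<close> could only belong to another
    tree of \<open>G\<close>, which would then be adjacent to the tree holding \<open>u\<close>.
    Thus \<open>tree_at\<close> returns the empty tree, as it should.\<close>
  have "u - 1 \<notin> Supp F" if "l = \<langle>\<rangle>"
  proof
    assume "u - 1 \<in> Supp F"
    then obtain T' where T': "T' \<in> F" "u - 1 \<in> set_tree T'" by (auto simp: Supp_def)
    have "T' \<noteq> r" using T'(2) r by auto
    then have "T' \<in> G" "T' \<noteq> ?T" using T'(1) that by (auto simp: F_def)
    then show False using other[OF _ _ T'(2), of u] u by simp
  qed
  moreover have "u + 1 \<notin> Supp F" if "r = \<langle>\<rangle>"
  proof
    assume "u + 1 \<in> Supp F"
    then obtain T' where T': "T' \<in> F" "u + 1 \<in> set_tree T'" by (auto simp: Supp_def)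
    have "T' \<noteq> l" using T'(2) l by auto
    then have "T' \<in> G" "T' \<noteq> ?T" using T'(1) that by (auto simp: F_def)
    then show False using other[OF _ _ T'(2), of u] u by simp
  qed
  moreover have "tree_at F (u - 1) = l" if "l \<noteq> \<langle>\<rangle>"
    using that int_l l by (intro tree_at_eqI[OF F]) (auto simp: F_def)
  moreover have "tree_at F (u + 1) = r" if "r \<noteq> \<langle>\<rangle>"
    using that int_r r by (intro tree_at_eqI[OF F]) (auto simp: F_def)
  ultimately have at: "tree_at F (u - 1) = l" "tree_at F (u + 1) = r"
    by fastforce+
  \<comment> \<open>Grafting deletes \<open>l\<close> and \<open>r\<close>; the result is
    \<open>G\<close> only if neither was already a tree of \<open>G\<close>.\<close>
  have nG: "T' \<notin> G" if T': "set_tree T' \<subseteq> {a..b}" "T' \<noteq> ?T" for T'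
  proof
    assume "T' \<in> G"
    moreover from this obtain c d where "c \<le> d" "set_tree T' = {c..d}"
      using indexed_forest_interval[OF G] by metis
    then have "c \<in> set_tree T'" by simp
    ultimately show False using other[of T' c c] T' by auto
  qed
  have "l \<noteq> ?T" "r \<noteq> ?T"
    using bst(3,4) by (metis less_irrefl tree.set_intros(2))+
  then have "l \<notin> G" "r \<notin> G"
    using nG[of l] nG[of r] l r u by auto
  moreover have "\<langle>\<rangle> \<notin> G" using Leaf_notin_indexed_forest[OF G] .
  ultimately have "G = graft F u"
    using T unfolding graft_def grafted_tree_def at unfolding F_def by auto
  then show ?thesis
    using that[OF F] Supp by blast
qed

section \<open>Labelings of a grafted forest\<close>

lemma left_child_graft:
  assumes F: "indexed_forest F"
  shows "left_child (graft F u) v w \<longleftrightarrow>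
    left_child F v w \<or> (w = u \<and> tree_at F (u - 1) \<noteq> \<langle>\<rangle> \<and> v = value (tree_at F (u - 1)))"
proof -
  \<comment> \<open>The quantifier over trees is moved inward to match the shape of
    \<open>nonempty_subtrees_graft\<close>.\<close>
  have "left_child G v w \<longleftrightarrow> (\<exists>l r r'. \<exists>T\<in>G. \<langle>\<langle>l, v, r\<rangle>, w, r'\<rangle> \<in> subtrees T)" for G
    unfolding left_child_def by blast
  then show ?thesis
    by (cases "tree_at F (u - 1)") (auto simp: nonempty_subtrees_graft[OF F] grafted_tree_def)
qed

lemma right_child_graft:
  assumes F: "indexed_forest F"
  shows "right_child (graft F u) v w \<longleftrightarrow>
    right_child F v w \<or> (w = u \<and> tree_at F (u + 1) \<noteq> \<langle>\<rangle> \<and> v = value (tree_at F (u + 1)))"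
proof -
  have "right_child G v w \<longleftrightarrow> (\<exists>l' l r. \<exists>T\<in>G. \<langle>l', w, \<langle>l, v, r\<rangle>\<rangle> \<in> subtrees T)" for G
    unfolding right_child_def by blast
  then show ?thesis
    by (cases "tree_at F (u + 1)") (auto simp: nonempty_subtrees_graft[OF F] grafted_tree_def)
qed

lemma set_subtree_subset: "t \<in> subtrees T \<Longrightarrow> set_tree t \<subseteq> set_tree T"
  by (induction T) auto

lemma subtree_root_in_Supp: "T \<in> F \<Longrightarrow> \<langle>l, u, r\<rangle> \<in> subtrees T \<Longrightarrow> u \<in> Supp F"
  using set_subtree_subset[of "\<langle>l, u, r\<rangle>" T] by (auto simp: Supp_def)

lemma left_child_in_Supp:
  assumes "left_child F v u"
  shows "u \<in> Supp F" "v \<in> Supp F"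
proof -
  from assms obtain T l r r' where T: "T \<in> F" "\<langle>\<langle>l, v, r\<rangle>, u, r'\<rangle> \<in> subtrees T"
    by (auto simp: left_child_def)
  show "u \<in> Supp F" "v \<in> Supp F"
    using set_subtree_subset[OF T(2)] T(1) by (auto simp: Supp_def)
qed

lemma right_child_in_Supp:
  assumes "right_child F v u"
  shows "u \<in> Supp F" "v \<in> Supp F"
proof -
  from assms obtain T l' l r where T: "T \<in> F" "\<langle>l', u, \<langle>l, v, r\<rangle>\<rangle> \<in> subtrees T"
    by (auto simp: right_child_def)
  show "u \<in> Supp F" "v \<in> Supp F"
    using set_subtree_subset[OF T(2)] T(1) by (auto simp: Supp_def)
qed

text \<open>The set of a node depends only on the subtree below it, and grafting adds a node only
  above old trees.\<close>

lemma INT_labels_graft: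
  assumes F: "indexed_forest F" and u: "u \<notin> Supp F"
  shows "INT_labels w (graft F u) = (if w = u then set_tree (grafted_tree F u) else INT_labels w F)"
proof -
  have "INT_labels w G = {x. \<exists>l r. (\<exists>T\<in>G. \<langle>l, w, r\<rangle> \<in> subtrees T) \<and> x \<in> set_tree \<langle>l, w, r\<rangle>}" for G
    unfolding INT_labels_def by blast
  moreover have "\<not> (\<exists>T\<in>F. \<langle>l, u, r\<rangle> \<in> subtrees T)" for l r
    using subtree_root_in_Supp u by blast
  ultimately show ?thesis
    by (auto simp: nonempty_subtrees_graft[OF F] grafted_tree_def)
qed

lemma value_in_Supp: "T \<in> F \<Longrightarrow> T \<noteq> \<langle>\<rangle> \<Longrightarrow> value T \<in> Supp F"
  by (cases T) (force simp: Supp_def)+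

lemma value_tree_at_in_Supp:
  "indexed_forest F \<Longrightarrow> tree_at F i \<noteq> \<langle>\<rangle> \<Longrightarrow> value (tree_at F i) \<in> Supp F"
  using tree_at_in_forest_or_Leaf value_in_Supp by metis

text \<open>Any subtree rooted at \<open>value T\<close> lies in a tree sharing this label with
  \<open>T\<close>, hence in \<open>T\<close> itself. Root labels are thereby located by block,
  which settles comparisons across blocks lexicographically.\<close>

lemma val_root_label:
  assumes F: "indexed_forest F" and T: "T \<in> F" and \<rho>: "\<rho> \<in> LBS F"
  shows "val (\<rho> (value T)) \<in> set_tree T"
proof -
  have ne: "T \<noteq> \<langle>\<rangle>" using T Leaf_notin_indexed_forest[OF F] by blast
  then have root: "value T \<in> set_tree T" by (cases T) auto
  have "val (\<rho> (value T)) \<in> INT_labels (value T) F"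
    using \<rho> value_in_Supp[OF T ne] by (simp add: LBS_def)
  then obtain T' l r where T': "T' \<in> F" "\<langle>l, value T, r\<rangle> \<in> subtrees T'"
    "val (\<rho> (value T)) \<in> set_tree \<langle>l, value T, r\<rangle>"
    by (auto simp: INT_labels_def)
  have "T' = T"
    using indexed_forest_gap[OF F T'(1) T _ root] set_subtree_subset[OF T'(2)] by auto
  then show ?thesis
    using set_subtree_subset[OF T'(2)] T'(3) by blast
qed

text \<open>The conditions that membership in \<open>LBS (graft F u)\<close> imposes at \<open>u\<close> when \<open>u\<close> is labeled \<open>a\<close>.\<close>

definition admissible :: "forest \<Rightarrow> (int \<Rightarrow> letter) \<Rightarrow> letter \<Rightarrow> int \<Rightarrow> bool" where
  "admissible F \<rho> a u \<longleftrightarrow> val a \<in> set_tree (grafted_tree F u) \<and>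
     (tree_at F (u - 1) \<noteq> \<langle>\<rangle> \<longrightarrow> \<rho> (value (tree_at F (u - 1))) < a) \<and>
     (tree_at F (u + 1) \<noteq> \<langle>\<rangle> \<longrightarrow> a < \<rho> (value (tree_at F (u + 1))))"

text \<open>Each defining condition splits into the old condition and one at \<open>u\<close>. The
  equivalence serves both directions of the correspondence: inserting a letter and removing a
  root.\<close>

lemma LBS_graft_iff:
  assumes F: "indexed_forest F" and u: "u \<notin> Supp F" and \<rho>u: "\<rho> u = undefined"
  shows "\<rho>(u := a) \<in> LBS (graft F u) \<longleftrightarrow>
    \<rho> \<in> LBS F \<and> a \<in> Zbar \<and> a \<notin> \<rho> ` Supp F \<and> admissible F \<rho> a u"
proof -
  let ?\<rho> = "\<rho>(u := a)"
  have same: "?\<rho> w = \<rho> w" if "w \<in> Supp F" for w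
    using that u by auto
  \<comment> \<open>The value \<open>undefined\<close> at \<open>u\<close> makes
    \<open>\<rho>\<close> extensional on the smaller support.\<close>
  have 1: "?\<rho> \<in> Supp (graft F u) \<rightarrow>\<^sub>E Zbar \<longleftrightarrow> \<rho> \<in> Supp F \<rightarrow>\<^sub>E Zbar \<and> a \<in> Zbar"
    using u \<rho>u unfolding Supp_graft[OF F] PiE_def Pi_def extensional_def
    by auto
  have im: "?\<rho> ` Supp F = \<rho> ` Supp F"
    using same by (rule image_cong[OF refl])
  have 2: "inj_on ?\<rho> (Supp (graft F u)) \<longleftrightarrow> inj_on \<rho> (Supp F) \<and> a \<notin> \<rho> ` Supp F"
    using u im inj_on_cong[of "Supp F" ?\<rho> \<rho>, OF same] by (simp add: Supp_graft[OF F])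
  have 3: "(\<forall>w v. left_child (graft F u) v w \<longrightarrow> ?\<rho> v < ?\<rho> w) \<longleftrightarrow>
      (\<forall>w v. left_child F v w \<longrightarrow> \<rho> v < \<rho> w) \<and>
      (tree_at F (u - 1) \<noteq> \<langle>\<rangle> \<longrightarrow> \<rho> (value (tree_at F (u - 1))) < a)"
    unfolding left_child_graft[OF F]
    using left_child_in_Supp same value_tree_at_in_Supp[OF F] by (metis fun_upd_same)
  have 4: "(\<forall>w v. right_child (graft F u) v w \<longrightarrow> ?\<rho> w < ?\<rho> v) \<longleftrightarrow>
      (\<forall>w v. right_child F v w \<longrightarrow> \<rho> w < \<rho> v) \<and>
      (tree_at F (u + 1) \<noteq> \<langle>\<rangle> \<longrightarrow> a < \<rho> (value (tree_at F (u + 1))))"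
    unfolding right_child_graft[OF F]
    using right_child_in_Supp same value_tree_at_in_Supp[OF F] by (metis fun_upd_same)
  have 5: "(\<forall>w\<in>Supp (graft F u). val (?\<rho> w) \<in> INT_labels w (graft F u)) \<longleftrightarrow>
      val a \<in> set_tree (grafted_tree F u) \<and> (\<forall>w\<in>Supp F. val (\<rho> w) \<in> INT_labels w F)"
    unfolding Supp_graft[OF F] INT_labels_graft[OF F u] using u by auto
  show ?thesis
    unfolding LBS_def mem_Collect_eq 1 2 3 4 5 admissible_def by blast
qed

text \<open>The old labels fill \<open>{1..n}\<close>, so the new root with label
  \<open>n + 1\<close> exceeds all of them and completes the range.\<close>

lemma decreasing_labelings_graft_iff:
  assumes F: "indexed_forest F" and u: "u \<notin> Supp F" and \<kappa>u: "\<kappa> u = undefined"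
  shows "\<kappa>(u := Suc (card (Supp F))) \<in> decreasing_labelings (graft F u) \<longleftrightarrow>
    \<kappa> \<in> decreasing_labelings F"
proof -
  let ?n = "card (Supp F)"
  let ?\<kappa> = "\<kappa>(u := Suc ?n)"
  have same: "?\<kappa> w = \<kappa> w" if "w \<in> Supp F" for w
    using that u by auto
  have card: "card (Supp (graft F u)) = Suc ?n"
    using u indexed_forest_finite[OF F] by (simp add: Supp_graft[OF F])
  have 1: "?\<kappa> \<in> extensional (Supp (graft F u)) \<longleftrightarrow> \<kappa> \<in> extensional (Supp F)"
    using u \<kappa>u by (auto simp: Supp_graft[OF F] extensional_def)
  have im: "?\<kappa> ` Supp F = \<kappa> ` Supp F"
    using same by (rule image_cong[OF refl])
  have 2: "bij_betw ?\<kappa> (Supp (graft F u)) {1..Suc ?n} \<longleftrightarrow> bij_betw \<kappa> (Supp F) {1..?n}"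
  proof -
    have ins: "{1..Suc ?n} = insert (Suc ?n) {1..?n}" "Suc ?n \<notin> {1..?n}" by auto
    have "bij_betw ?\<kappa> (Supp (graft F u)) {1..Suc ?n} \<longleftrightarrow>
        inj_on \<kappa> (Supp F) \<and> Suc ?n \<notin> \<kappa> ` Supp F \<and> insert (Suc ?n) (\<kappa> ` Supp F) = {1..Suc ?n}"
      using u im inj_on_cong[of "Supp F" ?\<kappa> \<kappa>, OF same]
      by (simp add: bij_betw_def Supp_graft[OF F])
    \<comment> \<open>The top value is fresh in both sets, so it can be cancelled.\<close>
    also have "\<dots> \<longleftrightarrow> bij_betw \<kappa> (Supp F) {1..?n}"
      unfolding bij_betw_def ins(1) using ins(2) by (metis insert_ident)
    finally show ?thesis .
  qed
  have less: "\<kappa> w < Suc ?n" if "bij_betw \<kappa> (Supp F) {1..?n}" "w \<in> Supp F" for w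
    using bij_betwE[OF that(1)] that(2) by fastforce
  \<comment> \<open>This equivalence is conditional: the comparisons at the new root hold because
    the bijection bounds the old labels.\<close>
  have 3: "(\<forall>w v. left_child (graft F u) v w \<or> right_child (graft F u) v w \<longrightarrow> ?\<kappa> v < ?\<kappa> w) \<longleftrightarrow>
      (\<forall>w v. left_child F v w \<or> right_child F v w \<longrightarrow> \<kappa> v < \<kappa> w)"
    if "bij_betw \<kappa> (Supp F) {1..?n}"
    unfolding left_child_graft[OF F] right_child_graft[OF F]
    using left_child_in_Supp right_child_in_Supp same value_tree_at_in_Supp[OF F] less[OF that]
    by (metis fun_upd_same)
  show ?thesis
    unfolding decreasing_labelings_def mem_Collect_eq card 1 2 using 3 by blast
qed

text \<open>Labels grow along the path to the root. The hypotheses speak of subtrees of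
  \<open>T\<close> instead of children in a forest, so that they pass to both subtrees in the
  induction.\<close>

lemma decreasing_le_root:
  fixes \<kappa> :: "int \<Rightarrow> nat"
  assumes "\<And>u v l r r'. \<langle>\<langle>l, v, r\<rangle>, u, r'\<rangle> \<in> subtrees T \<Longrightarrow> \<kappa> v < \<kappa> u"
    and "\<And>u v l' l r. \<langle>l', u, \<langle>l, v, r\<rangle>\<rangle> \<in> subtrees T \<Longrightarrow> \<kappa> v < \<kappa> u"
    and "x \<in> set_tree T"
  shows "\<kappa> x \<le> \<kappa> (value T)"
  using assms
proof (induction T)
  case (Node l u r)
  have subs: "subtrees l \<subseteq> subtrees \<langle>l, u, r\<rangle>" "subtrees r \<subseteq> subtrees \<langle>l, u, r\<rangle>" by auto
  from Node.prems(3) consider "x = u" | "x \<in> set_tree l" | "x \<in> set_tree r" by auto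
  then show ?case
  proof cases
    case 2
    then have "\<kappa> x \<le> \<kappa> (value l)"
      using Node.IH(1) Node.prems(1,2) subs by blast
    moreover obtain l1 v l2 where "l = \<langle>l1, v, l2\<rangle>"
      using 2 by (cases l) auto
    then have "\<kappa> (value l) < \<kappa> u"
      using Node.prems(1)[of l1 v l2 u r] by simp
    ultimately show ?thesis by simp
  next
    case 3
    then have "\<kappa> x \<le> \<kappa> (value r)"
      using Node.IH(2) Node.prems(1,2) subs by blast
    moreover obtain r1 v r2 where "r = \<langle>r1, v, r2\<rangle>"
      using 3 by (cases r) auto
    then have "\<kappa> (value r) < \<kappa> u"
      using Node.prems(2)[of l u r1 v r2] by simp
    ultimately show ?thesis by simp
  qed simp
qed simp

text \<open>The root of the tree containing the node labeled \<open>card (Supp F)\<close> has at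
  least that label, and no label is larger. This is the root that the last insertion step
  created.\<close>

lemma decreasing_labeling_max_root:
  assumes F: "indexed_forest F" and \<kappa>: "\<kappa> \<in> decreasing_labelings F" and ne: "Supp F \<noteq> {}"
  obtains l u r where "\<langle>l, u, r\<rangle> \<in> F" "\<kappa> u = card (Supp F)"
proof -
  have bij: "bij_betw \<kappa> (Supp F) {1..card (Supp F)}"
    using \<kappa> by (simp add: decreasing_labelings_def)
  have "card (Supp F) \<in> {1..card (Supp F)}"
    using ne indexed_forest_finite[OF F] by (simp add: Suc_le_eq card_gt_0_iff)
  then obtain x where x: "x \<in> Supp F" "\<kappa> x = card (Supp F)"
    using bij by (metis bij_betw_iff_bijections)
  then obtain T where T: "T \<in> F" "x \<in> set_tree T" by (auto simp: Supp_def)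
  then obtain l u r where lur: "T = \<langle>l, u, r\<rangle>" by (cases T) auto
  have "\<kappa> x \<le> \<kappa> (value T)"
  proof (rule decreasing_le_root[OF _ _ T(2)])
    show "\<kappa> v < \<kappa> u" if "\<langle>\<langle>l, v, r\<rangle>, u, r'\<rangle> \<in> subtrees T" for u v l r r'
      using \<kappa> T(1) that unfolding decreasing_labelings_def left_child_def by blast
    show "\<kappa> v < \<kappa> u" if "\<langle>l', u, \<langle>l, v, r\<rangle>\<rangle> \<in> subtrees T" for u v l' l r
      using \<kappa> T(1) that unfolding decreasing_labelings_def right_child_def by blast
  qed
  moreover have "\<kappa> u \<le> card (Supp F)"
    using bij_betwE[OF bij] value_in_Supp[OF T(1)] lur by auto
  ultimately show ?thesis
    using that T(1) lur x(2) by simp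
qed

section \<open>The insertion step\<close>

text \<open>The position of \<open>val a\<close> in the grafted tree decides the rule: (i) at the
  root, (ii) in the left subtree, (iii) in the right one. As \<open>u\<close> is an arbitrary
  admissible label, this also shows that there is at most one.\<close>

lemma new_tree_eq_grafted:
  assumes F: "indexed_forest F" and u: "u \<notin> Supp F" and adm: "admissible F \<rho> a u"
  shows "new_tree F \<rho> a = grafted_tree F u"
proof -
  let ?l = "tree_at F (u - 1)" and ?r = "tree_at F (u + 1)"
  from adm consider "val a = u" | "val a \<in> set_tree ?l" | "val a \<in> set_tree ?r"
    by (auto simp: admissible_def grafted_tree_def)
  then show ?thesis
  proof cases
    case 1
    then show ?thesis using u by (simp add: new_tree_def grafted_tree_def Let_def)
  next
    case 2
    then have l: "?l \<in> F" "?l \<noteq> \<langle>\<rangle>" using tree_at_in_forest_or_Leaf[OF F] by force+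
    have at: "tree_at F (val a) = ?l" by (rule tree_at_eqI[OF F l(1) 2])
    have S: "val a \<in> Supp F" using 2 set_tree_at_subset[OF F] by blast
    obtain m where m: "set_tree ?l = {m..u - 1}" using set_tree_at_below[OF F u] .
    have "m \<le> u - 1" using 2 unfolding m by simp
    \<comment> \<open>Hence \<open>M + 1\<close> and \<open>M + 2\<close> in \<open>new_tree\<close>
      are \<open>u\<close> and \<open>u + 1\<close>.\<close>
    then have "Max (set_tree ?l) = u - 1" unfolding m by (intro Max_eqI) auto
    then show ?thesis
      using adm l(2) S by (simp add: new_tree_def grafted_tree_def Let_def at admissible_def add.commute)
  next
    case 3
    then have r: "?r \<in> F" "?r \<noteq> \<langle>\<rangle>" using tree_at_in_forest_or_Leaf[OF F] by force+
    have at: "tree_at F (val a) = ?r" by (rule tree_at_eqI[OF F r(1) 3])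
    have S: "val a \<in> Supp F" using 3 set_tree_at_subset[OF F] by blast
    obtain m where m: "set_tree ?r = {u + 1..m}" using set_tree_at_above[OF F u] .
    have "u + 1 \<le> m" using 3 unfolding m by simp
    \<comment> \<open>Hence \<open>m - 1\<close> and \<open>m - 2\<close> in \<open>new_tree\<close>
      are \<open>u\<close> and \<open>u - 1\<close>.\<close>
    then have "Min (set_tree ?r) = u + 1" unfolding m by (intro Min_eqI) auto
    moreover have "\<not> a > \<rho> (value ?r)"
      using adm r(2) by (auto simp: admissible_def)
    ultimately show ?thesis
      using S by (simp add: new_tree_def grafted_tree_def Let_def at)
  qed
qed

text \<open>A free \<open>val a\<close> is itself the new label. Otherwise the new root goes just
  beyond the right or left end of the block of \<open>val a\<close>, according to how
  \<open>a\<close> compares with the root label there.\<close>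

lemma admissible_exists:
  assumes F: "indexed_forest F" and \<rho>: "\<rho> \<in> LBS F" and a: "a \<notin> \<rho> ` Supp F"
  obtains u where "u \<notin> Supp F" "admissible F \<rho> a u"
proof -
  \<comment> \<open>The root label of the tree ending at \<open>u - 1\<close> has value less than
    \<open>u\<close>, hence less than \<open>val a\<close>, so the first coordinate decides.\<close>
  have below: "\<rho> (value (tree_at F (u - 1))) < a"
    if u: "u \<notin> Supp F" "u \<le> val a" "tree_at F (u - 1) \<noteq> \<langle>\<rangle>" for u
  proof -
    have "val (\<rho> (value (tree_at F (u - 1)))) \<in> set_tree (tree_at F (u - 1))"
      using u(3) tree_at_in_forest_or_Leaf[OF F] val_root_label[OF F _ \<rho>] by blast
    moreover obtain m where "set_tree (tree_at F (u - 1)) = {m..u - 1}"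
      using set_tree_at_below[OF F u(1)] .
    ultimately show ?thesis using u(2) by (simp add: less_prod_def')
  qed
  have above: "a < \<rho> (value (tree_at F (u + 1)))"
    if u: "u \<notin> Supp F" "val a \<le> u" "tree_at F (u + 1) \<noteq> \<langle>\<rangle>" for u
  proof -
    have "val (\<rho> (value (tree_at F (u + 1)))) \<in> set_tree (tree_at F (u + 1))"
      using u(3) tree_at_in_forest_or_Leaf[OF F] val_root_label[OF F _ \<rho>] by blast
    moreover obtain m where "set_tree (tree_at F (u + 1)) = {u + 1..m}"
      using set_tree_at_above[OF F u(1)] .
    ultimately show ?thesis using u(2) by (simp add: less_prod_def')
  qed
  show ?thesis
  proof (cases "val a \<in> Supp F")
    case False
    then have "admissible F \<rho> a (val a)"
      using below[of "val a"] above[of "val a"] by (simp add: admissible_def grafted_tree_def)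
    then show ?thesis using that False by blast
  next
    case True
    define T where "T = tree_at F (val a)"
    have T: "T \<in> F" "val a \<in> set_tree T"
      using tree_at_mem[OF F True] by (simp_all add: T_def)
    obtain m M where mM: "m \<le> M" "set_tree T = {m..M}"
      using indexed_forest_interval[OF F T(1)] .
    have out: "x \<notin> Supp F" if "x \<notin> set_tree T" "y \<in> set_tree T" "\<bar>x - y\<bar> \<le> 1" for x y
      using indexed_forest_gap[OF F _ T(1) _ that(2,3)] that(1) by (auto simp: Supp_def)
    have "a \<noteq> \<rho> (value T)"
      using a value_in_Supp[OF T(1)] T(2) by fastforce
    then consider "\<rho> (value T) < a" | "a < \<rho> (value T)" by fastforce
    then show ?thesis
    proof cases
      case 1
      \<comment> \<open>Here \<open>T\<close> becomes the left subtree; a tree starting at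
        \<open>M + 2\<close> is compared with \<open>a\<close> by \<open>above\<close>, since
        \<open>val a\<close> is at most \<open>M\<close>.\<close>
      have u: "M + 1 \<notin> Supp F" using mM by (intro out[of _ M]) auto
      have at: "tree_at F (M + 1 - 1) = T" using mM by (intro tree_at_eqI[OF F T(1)]) auto
      have "admissible F \<rho> a (M + 1)"
        using above[OF u] T(2) mM 1 unfolding admissible_def grafted_tree_def at by auto
      then show ?thesis using that u by blast
    next
      case 2
      have u: "m - 1 \<notin> Supp F" using mM by (intro out[of _ m]) auto
      have at: "tree_at F (m - 1 + 1) = T" using mM by (intro tree_at_eqI[OF F T(1)]) auto
      have "admissible F \<rho> a (m - 1)"
        using below[OF u] T(2) mM 2 unfolding admissible_def grafted_tree_def at by auto
      then show ?thesis using that u by blast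
    qed
  qed
qed

lemma insertion_snoc_graft:
  assumes "insertion W = (F, \<rho>, \<kappa>)" "indexed_forest F" "u \<notin> Supp F" "admissible F \<rho> a u"
  shows "insertion (W @ [a]) = (graft F u, \<rho>(u := a), \<kappa>(u := Suc (length W)))"
  using new_tree_eq_grafted[OF assms(2-4)] assms(1)
  by (simp add: insertion_snoc grafted_tree_def graft_def)

section \<open>The correspondence\<close>

text \<open>The common forest is stored once here, matching the output of \<open>insertion\<close>;
  the two symbols each carry a copy.\<close>

definition labeled_triples :: "(forest \<times> (int \<Rightarrow> letter) \<times> (int \<Rightarrow> nat)) set" where
  "labeled_triples =
     {(F, \<rho>, \<kappa>). indexed_forest F \<and> \<rho> \<in> LBS F \<and> \<kappa> \<in> decreasing_labelings F}"

lemma LBS_undefined: "\<rho> \<in> LBS F \<Longrightarrow> u \<notin> Supp F \<Longrightarrow> \<rho> u = undefined"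
  by (auto simp: LBS_def)

lemma decreasing_labelings_undefined:
  "\<kappa> \<in> decreasing_labelings F \<Longrightarrow> u \<notin> Supp F \<Longrightarrow> \<kappa> u = undefined"
  by (auto simp: decreasing_labelings_def extensional_def)

lemma injective_words_snoc:
  "W @ [a] \<in> injective_words \<longleftrightarrow> W \<in> injective_words \<and> a \<in> Zbar \<and> a \<notin> set W"
  by (auto simp: injective_words_def)

text \<open>The last two conjuncts carry the induction: the first makes a letter outside
  \<open>set W\<close> new to the labeling, the second identifies the label
  \<open>Suc (length W)\<close> with \<open>Suc (card (Supp F))\<close>.\<close>

lemma insertion_invariant:
  assumes "W \<in> injective_words" "insertion W = (F, \<rho>, \<kappa>)"
  shows "indexed_forest F \<and> \<rho> \<in> LBS F \<and> \<kappa> \<in> decreasing_labelings F \<and>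
    \<rho> ` Supp F = set W \<and> card (Supp F) = length W"
  using assms
proof (induction W arbitrary: F \<rho> \<kappa> rule: rev_induct)
  case Nil
  then show ?case
    by (auto simp: insertion_Nil indexed_forest_def Supp_def blocks_def LBS_def left_child_def
        right_child_def decreasing_labelings_def bij_betw_def)
next
  case (snoc a W)
  obtain F0 \<rho>0 \<kappa>0 where W: "insertion W = (F0, \<rho>0, \<kappa>0)" by (metis prod_cases3)
  have inj: "W \<in> injective_words" "a \<in> Zbar" "a \<notin> set W"
    using snoc.prems(1) by (auto simp: injective_words_snoc)
  have IH: "indexed_forest F0" "\<rho>0 \<in> LBS F0" "\<kappa>0 \<in> decreasing_labelings F0"
    "\<rho>0 ` Supp F0 = set W" "card (Supp F0) = length W"
    using snoc.IH[OF inj(1) W] by auto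
  then obtain u where u: "u \<notin> Supp F0" "admissible F0 \<rho>0 a u"
    using admissible_exists[OF IH(1,2), of a] inj(3) by blast
  have eq: "F = graft F0 u" "\<rho> = \<rho>0(u := a)" "\<kappa> = \<kappa>0(u := Suc (length W))"
    using insertion_snoc_graft[OF W IH(1) u] snoc.prems(2) by auto
  have "\<rho> ` Supp F0 = \<rho>0 ` Supp F0"
    using u(1) unfolding eq by (intro image_cong) auto
  then have "\<rho> ` Supp F = set (W @ [a])"
    using IH(4) by (simp add: eq(1) Supp_graft[OF IH(1)]) (simp add: eq)
  moreover have "card (Supp F) = length (W @ [a])"
    using u(1) IH(5) indexed_forest_finite[OF IH(1)] by (simp add: eq Supp_graft[OF IH(1)])
  moreover have "\<rho> \<in> LBS F"
    using LBS_graft_iff[of F0 u \<rho>0 a] LBS_undefined[OF IH(2) u(1)] IH inj u eq by simp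
  moreover have "\<kappa> \<in> decreasing_labelings F"
    using decreasing_labelings_graft_iff[of F0 u \<kappa>0] decreasing_labelings_undefined[OF IH(3) u(1)]
      IH u eq by simp
  ultimately show ?case
    using indexed_forest_graft[OF IH(1) u(1)] eq(1) by simp
qed

text \<open>Prepares for undoing a step: since both old labelings are \<open>undefined\<close> at
  \<open>u\<close>, they can be read off from their updates.\<close>

lemma insertion_snoc_cases:
  assumes "W @ [a] \<in> injective_words"
  obtains F \<rho> \<kappa> u where "insertion W = (F, \<rho>, \<kappa>)" "indexed_forest F" "u \<notin> Supp F"
    "\<rho> u = undefined" "\<kappa> u = undefined"
    "insertion (W @ [a]) = (graft F u, \<rho>(u := a), \<kappa>(u := Suc (length W)))"
proof -
  obtain F \<rho> \<kappa> where W: "insertion W = (F, \<rho>, \<kappa>)" by (metis prod_cases3)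
  have inj: "W \<in> injective_words" "a \<notin> set W"
    using assms by (auto simp: injective_words_snoc)
  have I: "indexed_forest F" "\<rho> \<in> LBS F" "\<kappa> \<in> decreasing_labelings F" "\<rho> ` Supp F = set W"
    using insertion_invariant[OF inj(1) W] by simp_all
  obtain u where u: "u \<notin> Supp F" "admissible F \<rho> a u"
    using admissible_exists[OF I(1,2), of a] inj(2) I(4) by blast
  show ?thesis
    using that[OF W I(1) u(1) LBS_undefined[OF I(2) u(1)]
        decreasing_labelings_undefined[OF I(3) u(1)] insertion_snoc_graft[OF W I(1) u]] .
qed

text \<open>The forest fixes the length of the word, the largest decreasing label fixes the root
  created last, and removing that root determines the last letter and the previous triple.\<close>

lemma inj_on_insertion: "inj_on insertion injective_words"
proof (rule inj_onI)
  fix W W' assume "W \<in> injective_words" "W' \<in> injective_words" "insertion W = insertion W'"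
  then show "W = W'"
  proof (induction W arbitrary: W' rule: rev_induct)
    case Nil
    then show ?case
      using insertion_invariant[OF Nil(2) Nil(3)[symmetric, unfolded insertion_Nil]] by (simp add: Supp_def)
  next
    case (snoc a W)
    obtain G \<rho>\<^sub>G \<kappa>\<^sub>G where G: "insertion (W @ [a]) = (G, \<rho>\<^sub>G, \<kappa>\<^sub>G)" by (metis prod_cases3)
    note IG = insertion_invariant[OF snoc.prems(1) G]
    have "length W' = Suc (length W)"
      using IG insertion_invariant[OF snoc.prems(2), of G \<rho>\<^sub>G \<kappa>\<^sub>G] snoc.prems(3) G by simp
    then obtain V b where V: "W' = V @ [b]" and len: "length V = length W"
      by (cases W' rule: rev_cases) auto
    obtain F \<rho> \<kappa> u where 1: "insertion W = (F, \<rho>, \<kappa>)" "indexed_forest F" "u \<notin> Supp F"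
      "\<rho> u = undefined" "\<kappa> u = undefined"
      "insertion (W @ [a]) = (graft F u, \<rho>(u := a), \<kappa>(u := Suc (length W)))"
      using insertion_snoc_cases[OF snoc.prems(1)] .
    obtain F' \<rho>' \<kappa>' u' where 2: "insertion V = (F', \<rho>', \<kappa>')" "indexed_forest F'" "u' \<notin> Supp F'"
      "\<rho>' u' = undefined" "\<kappa>' u' = undefined"
      "insertion (V @ [b]) = (graft F' u', \<rho>'(u' := b), \<kappa>'(u' := Suc (length V)))"
      using insertion_snoc_cases[OF snoc.prems(2)[unfolded V]] .
    have eq: "G = graft F u" "G = graft F' u'" "\<rho>(u := a) = \<rho>'(u' := b)"
      "\<kappa>\<^sub>G = \<kappa>(u := Suc (length W))" "\<kappa>\<^sub>G = \<kappa>'(u' := Suc (length W))"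
      using G 1(6) 2(6) snoc.prems(3) V len by auto
    \<comment> \<open>The label \<open>Suc (length W)\<close> is attained at both \<open>u\<close>
      and \<open>u'\<close>, so injectivity identifies them.\<close>
    have "inj_on \<kappa>\<^sub>G (Supp G)"
      using IG by (simp add: decreasing_labelings_def bij_betw_def)
    moreover have "u \<in> Supp G"
      using Supp_graft[OF 1(2), of u] eq(1) by simp
    moreover have "u' \<in> Supp G"
      using Supp_graft[OF 2(2), of u'] eq(2) by simp
    moreover have "\<kappa>\<^sub>G u = \<kappa>\<^sub>G u'"
      using fun_cong[OF eq(4), of u] fun_cong[OF eq(5), of u'] by simp
    ultimately have u: "u' = u"
      by (metis inj_onD)
    have "F' = F"
      using inj_graft[OF 1(2,3), of F'] 2(2,3) eq(1,2) u by metis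
    moreover have "\<rho>' = \<rho>"
      using eq(3) 1(4) 2(4) unfolding u by (metis fun_upd_triv fun_upd_upd)
    moreover have "\<kappa>' = \<kappa>"
      using eq(4,5) 1(5) 2(5) unfolding u by (metis fun_upd_triv fun_upd_upd)
    moreover have "a = b"
      using fun_cong[OF eq(3), of u] u by simp
    ultimately show ?case
      using snoc.IH[of V] snoc.prems(1,2) 1(1) 2(1) V by (simp add: injective_words_snoc)
  qed
qed

text \<open>Induction on the number of nodes: the root with the largest decreasing label is taken
  off, and its label under \<open>\<rho>\<close> becomes the last letter.\<close>

lemma insertion_surj:
  assumes "indexed_forest F" "\<rho> \<in> LBS F" "\<kappa> \<in> decreasing_labelings F"
  obtains W where "W \<in> injective_words" "insertion W = (F, \<rho>, \<kappa>)"
proof -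
  have "\<exists>W\<in>injective_words. insertion W = (F, \<rho>, \<kappa>)"
    using assms
  proof (induction "card (Supp F)" arbitrary: F \<rho> \<kappa>)
    case 0
    then have S: "Supp F = {}" using indexed_forest_finite by force
    then have "T = \<langle>\<rangle>" if "T \<in> F" for T
      using that by (cases T) (auto simp: Supp_def)
    then have "F = {}" using Leaf_notin_indexed_forest[OF 0(2)] by blast
    moreover have "\<rho> = (\<lambda>_. undefined)" "\<kappa> = (\<lambda>_. undefined)"
      using LBS_undefined[OF 0(3)] decreasing_labelings_undefined[OF 0(4)] S by auto
    ultimately show ?case
      by (intro bexI[of _ "[]"]) (auto simp: insertion_Nil injective_words_def)
  next
    case (Suc n)
    have "Supp F \<noteq> {}" using Suc.hyps(2) by auto
    then obtain l u r where T: "\<langle>l, u, r\<rangle> \<in> F" and \<kappa>u: "\<kappa> u = card (Supp F)"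
      using decreasing_labeling_max_root[OF Suc.prems(1,3)] by blast
    obtain F' where F': "indexed_forest F'" "u \<notin> Supp F'" "F = graft F' u"
      using graft_surj[OF Suc.prems(1) T] .
    \<comment> \<open>Resetting to \<open>undefined\<close> makes the restricted labelings
      extensional on the support of \<open>F'\<close>.\<close>
    define \<rho>' where "\<rho>' = \<rho>(u := undefined)"
    define \<kappa>' where "\<kappa>' = \<kappa>(u := undefined)"
    have n: "n = card (Supp F')"
      using Suc.hyps(2) F'(2) indexed_forest_finite[OF F'(1)] by (simp add: F'(3) Supp_graft[OF F'(1)])
    have \<rho>: "\<rho> = \<rho>'(u := \<rho> u)" and \<kappa>: "\<kappa> = \<kappa>'(u := Suc (card (Supp F')))"
      using \<kappa>u Suc.hyps(2) n by (auto simp: \<rho>'_def \<kappa>'_def)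
    have "\<rho>'(u := \<rho> u) \<in> LBS (graft F' u)"
      unfolding \<rho>[symmetric] F'(3)[symmetric] by (rule Suc.prems(2))
    moreover have "\<rho>' u = undefined" by (simp add: \<rho>'_def)
    ultimately have \<rho>': "\<rho>' \<in> LBS F'" "\<rho> u \<in> Zbar" "\<rho> u \<notin> \<rho>' ` Supp F'" "admissible F' \<rho>' (\<rho> u) u"
      using LBS_graft_iff[OF F'(1,2), of \<rho>' "\<rho> u"] by simp_all
    have "\<kappa>'(u := Suc (card (Supp F'))) \<in> decreasing_labelings (graft F' u)"
      unfolding \<kappa>[symmetric] F'(3)[symmetric] by (rule Suc.prems(3))
    then have \<kappa>': "\<kappa>' \<in> decreasing_labelings F'"
      using decreasing_labelings_graft_iff[OF F'(1,2), of \<kappa>'] by (simp add: \<kappa>'_def)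
    obtain W where W: "W \<in> injective_words" "insertion W = (F', \<rho>', \<kappa>')"
      using Suc.hyps(1)[OF n F'(1) \<rho>'(1) \<kappa>'] by blast
    note I = insertion_invariant[OF W]
    then have len: "length W = card (Supp F')" by simp
    have "insertion (W @ [\<rho> u]) = (F, \<rho>, \<kappa>)"
      using insertion_snoc_graft[OF W(2) F'(1,2) \<rho>'(4)]
      unfolding len \<rho>[symmetric] \<kappa>[symmetric] F'(3)[symmetric] .
    \<comment> \<open>The letter is fresh because \<open>\<rho>'\<close> takes exactly the letters
      of \<open>W\<close> as its values on the support of \<open>F'\<close>.\<close>
    moreover have "W @ [\<rho> u] \<in> injective_words"
      using W(1) \<rho>' I by (simp add: injective_words_snoc)
    ultimately show ?case by blast
  qed
  then show ?thesis using that by blast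
qed

theorem bij_betw_insertion: "bij_betw insertion injective_words labeled_triples"
proof (rule bij_betw_imageI[OF inj_on_insertion])
  show "insertion ` injective_words = labeled_triples"
  proof (intro equalityI subsetI)
    fix t assume "t \<in> insertion ` injective_words"
    then obtain W where "W \<in> injective_words" "insertion W = t" by blast
    then show "t \<in> labeled_triples"
      using insertion_invariant by (cases t) (auto simp: labeled_triples_def)
  next
    fix t assume "t \<in> labeled_triples"
    then show "t \<in> insertion ` injective_words"
      unfolding labeled_triples_def by (auto elim!: insertion_surj) (metis image_eqI)
  qed
qed

theorem theorem5p1:
  shows "bij_betw (\<lambda>W. (P_symbol W, Q_symbol W)) injective_words
    {((F, \<rho>), (F, \<kappa>)) | F \<rho> \<kappa>.
       indexed_forest F \<and> \<rho> \<in> LBS F \<and> \<kappa> \<in> decreasing_labelings F}"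
proof -
  \<comment> \<open>Repeating the common forest is injective and carries triples onto the required
    pairs.\<close>
  let ?dup = "\<lambda>(F, \<rho>, \<kappa>). ((F, \<rho>), (F, \<kappa>))"
  have "bij_betw ?dup labeled_triples
      {((F, \<rho>), (F, \<kappa>)) | F \<rho> \<kappa>.
         indexed_forest F \<and> \<rho> \<in> LBS F \<and> \<kappa> \<in> decreasing_labelings F}"
    by (rule bij_betw_imageI) (force simp: inj_on_def labeled_triples_def image_def)+
  then have "bij_betw (?dup \<circ> insertion) injective_words
      {((F, \<rho>), (F, \<kappa>)) | F \<rho> \<kappa>.
         indexed_forest F \<and> \<rho> \<in> LBS F \<and> \<kappa> \<in> decreasing_labelings F}"
    by (rule bij_betw_trans[OF bij_betw_insertion])
  moreover have "?dup \<circ> insertion = (\<lambda>W. (P_symbol W, Q_symbol W))"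
    by (auto simp: fun_eq_iff P_symbol_def Q_symbol_def split: prod.split)
  ultimately show ?thesis by simp
qed

end
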